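(* Let $\{a_i\}_{i \geq 0}$ and $\{c_j\}_{j\geq 0}$ be sequences of real numbers with $a_i > 0$ and $c_j > 0$ for all $i,j$, and suppose that the lower triangular factorable matrix $M = M(\{a_i\},\{c_j\})$ (with entries $m_{ij} = a_i c_j$ for $j \leq i$ and $m_{ij} = 0$ for $j > i$) is a bounded operator on $\ell^2$. Assume that the sequence $\left\{\frac{a_k}{c_k}\right\}_{k \geq 0}$ is strictly decreasing to $0$ and that the sequence $\left\{\frac{a_k c_k}{a_{k+1}c_{k+1}}\right\}_{k\geq 0}$ is bounded. If there exists a $\delta > 0$ such that $0 < c_0 a_0 \leq \delta$ and $$\frac{1}{\delta}\,\frac{a_k}{c_k}\,(\delta - c_k a_k) \;\leq\; \frac{a_{k+1}}{c_{k+1}} \;\leq\; \frac{\delta\,\frac{a_k}{c_k}}{\delta + c_{k+1}^2\,\frac{a_k}{c_k}}$$ for each nonnegative integer $k$, then $M$ is hyponormal.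
   Context: $\ell^2 = \ell^2(\{0,1,2,\dots\})$ is the complex Hilbert space of square-summable sequences; an infinite matrix with rows and columns indexed by $0,1,2,\dots$ acts on $\ell^2$ by matrix multiplication. A bounded operator $T$ on a Hilbert space is hyponormal if $T^*T - TT^*$ is positive semidefinite. *)

theory Defs
  imports "HOL-Analysis.Analysis"
begin

section \<open>The complex Hilbert space of square-summable sequences\<close>

typedef ell2 = "{x :: nat \<Rightarrow> complex. summable (\<lambda>n. (cmod (x n))\<^sup>2)}"
  morphisms seq Abs_ell2
  by (rule exI[of _ "\<lambda>_. 0"]) simp

setup_lifting type_definition_ell2

lemma summable_seq: "summable (\<lambda>n. (cmod (seq x n))\<^sup>2)"
  using seq[of x] by simp

lemma summable_mult_square_summable:
  assumes "summable (\<lambda>n. (cmod (f n))\<^sup>2)" "summable (\<lambda>n. (cmod (g n))\<^sup>2)"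
  shows "summable (\<lambda>n. cmod (f n) * cmod (g n))"
proof (rule summable_comparison_test')
  show "summable (\<lambda>n. (cmod (f n))\<^sup>2 + (cmod (g n))\<^sup>2)"
    by (intro summable_add assms)
  show "norm (cmod (f n) * cmod (g n)) \<le> (cmod (f n))\<^sup>2 + (cmod (g n))\<^sup>2" if "n \<ge> 0" for n
  proof -
    have "0 \<le> cmod (f n) * cmod (g n)" by simp
    moreover have "2 * (cmod (f n) * cmod (g n)) \<le> (cmod (f n))\<^sup>2 + (cmod (g n))\<^sup>2"
      using sum_squares_bound[of "cmod (f n)" "cmod (g n)"] by (simp add: mult.assoc)
    ultimately show ?thesis unfolding real_norm_def by linarith
  qed
qed

lemma square_summable_add:
  assumes "summable (\<lambda>n. (cmod (f n))\<^sup>2)" "summable (\<lambda>n. (cmod (g n))\<^sup>2)"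
  shows "summable (\<lambda>n. (cmod (f n + g n))\<^sup>2)"
proof (rule summable_comparison_test')
  show "summable (\<lambda>n. (cmod (f n))\<^sup>2 + 2 * (cmod (f n) * cmod (g n)) + (cmod (g n))\<^sup>2)"
    by (intro summable_add summable_mult summable_mult_square_summable assms)
  show "norm ((cmod (f n + g n))\<^sup>2)
      \<le> (cmod (f n))\<^sup>2 + 2 * (cmod (f n) * cmod (g n)) + (cmod (g n))\<^sup>2" if "n \<ge> 0" for n
    using power_mono[OF norm_triangle_ineq[of "f n" "g n"], of 2]
    by (simp add: power2_sum algebra_simps)
qed

lemma square_summable_scale:
  assumes "summable (\<lambda>n. (cmod (f n))\<^sup>2)"
  shows "summable (\<lambda>n. (cmod (k * f n))\<^sup>2)"
  using summable_mult[OF assms, of "(cmod k)\<^sup>2"] by (simp add: norm_mult power_mult_distrib)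

lift_definition scaleC_ell2 :: "complex \<Rightarrow> ell2 \<Rightarrow> ell2" (infixr \<open>*\<^sub>C\<close> 75)
  is "\<lambda>k x n. k * x n"
  by (rule square_summable_scale)

instantiation ell2 :: real_vector
begin

lift_definition zero_ell2 :: ell2 is "\<lambda>_. 0" by simp

lift_definition plus_ell2 :: "ell2 \<Rightarrow> ell2 \<Rightarrow> ell2" is "\<lambda>x y n. x n + y n"
  by (rule square_summable_add)

lift_definition minus_ell2 :: "ell2 \<Rightarrow> ell2 \<Rightarrow> ell2" is "\<lambda>x y n. x n - y n"
  subgoal for f g using square_summable_add[of f "\<lambda>n. - g n"] by simp
  done

lift_definition uminus_ell2 :: "ell2 \<Rightarrow> ell2" is "\<lambda>x n. - x n" by simp

lift_definition scaleR_ell2 :: "real \<Rightarrow> ell2 \<Rightarrow> ell2" is "\<lambda>r x n. r *\<^sub>R x n"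
  by (simp add: power_mult_distrib summable_mult)

instance
  by standard (transfer; simp add: fun_eq_iff algebra_simps)+

end

lemma summable_inner_seq: "summable (\<lambda>n. seq x n \<bullet> seq y n)"
proof (rule summable_comparison_test')
  show "summable (\<lambda>n. cmod (seq x n) * cmod (seq y n))"
    by (intro summable_mult_square_summable summable_seq)
qed (simp add: Cauchy_Schwarz_ineq2)

text \<open>The real inner product below is the real part of \<open>cinner\<close> (see \<open>inner_eq_Re_cinner\<close>);
  it makes the norm \<open>sqrt (\<Sum>n. \<bar>x\<^sub>n\<bar>\<^sup>2)\<close>.\<close>

instantiation ell2 :: real_inner
begin

definition inner_ell2 :: "ell2 \<Rightarrow> ell2 \<Rightarrow> real"
  where "inner_ell2 x y = (\<Sum>n. seq x n \<bullet> seq y n)"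

definition norm_ell2 :: "ell2 \<Rightarrow> real"
  where "norm_ell2 x = sqrt (\<Sum>n. (cmod (seq x n))\<^sup>2)"

definition dist_ell2 :: "ell2 \<Rightarrow> ell2 \<Rightarrow> real"
  where "dist_ell2 x y = norm (x - y)"

definition sgn_ell2 :: "ell2 \<Rightarrow> ell2"
  where "sgn_ell2 x = x /\<^sub>R norm x"

definition uniformity_ell2 :: "(ell2 \<times> ell2) filter"
  where "uniformity_ell2 = (INF e\<in>{0<..}. principal {(x, y). dist x y < e})"

definition open_ell2 :: "ell2 set \<Rightarrow> bool"
  where "open_ell2 U \<longleftrightarrow> (\<forall>x\<in>U. \<forall>\<^sub>F (x', y) in uniformity. x' = x \<longrightarrow> y \<in> U)"

instance
proof
  fix x y z :: ell2 and r :: real and U :: "ell2 set"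
  show "dist x y = norm (x - y)" by (rule dist_ell2_def)
  show "sgn x = x /\<^sub>R norm x" by (rule sgn_ell2_def)
  show "uniformity = (INF e\<in>{0<..}. principal {(x :: ell2, y). dist x y < e})"
    by (rule uniformity_ell2_def)
  show "open U \<longleftrightarrow> (\<forall>x\<in>U. \<forall>\<^sub>F (x', y) in uniformity. x' = x \<longrightarrow> y \<in> U)"
    by (rule open_ell2_def)
  show "x \<bullet> y = y \<bullet> x"
    by (simp add: inner_ell2_def inner_commute)
  show "(x + y) \<bullet> z = x \<bullet> z + y \<bullet> z"
    by (simp add: inner_ell2_def plus_ell2.rep_eq inner_add_left suminf_add summable_inner_seq)
  show "(r *\<^sub>R x) \<bullet> y = r * (x \<bullet> y)"
    by (simp add: inner_ell2_def scaleR_ell2.rep_eq suminf_mult summable_inner_seq del: inner_complex_def)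
  show nonneg: "0 \<le> x \<bullet> x"
    unfolding inner_ell2_def by (intro suminf_nonneg summable_inner_seq) simp
  show "(x \<bullet> x = 0) = (x = 0)"
  proof -
    have "(\<Sum>n. seq x n \<bullet> seq x n) = 0 \<longleftrightarrow> (\<forall>n. seq x n \<bullet> seq x n = 0)"
      by (intro suminf_eq_zero_iff summable_inner_seq) simp
    then show ?thesis
      by (simp add: inner_ell2_def seq_inject[symmetric] zero_ell2.rep_eq fun_eq_iff)
  qed
  show "norm x = sqrt (x \<bullet> x)"
    by (simp add: norm_ell2_def inner_ell2_def dot_square_norm)
qed

end

definition cinner :: "ell2 \<Rightarrow> ell2 \<Rightarrow> complex"
  where "cinner x y = (\<Sum>n. seq x n * cnj (seq y n))"

lemma summable_cinner: "summable (\<lambda>n. seq x n * cnj (seq y n))"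
proof (rule summable_norm_cancel)
  show "summable (\<lambda>n. norm (seq x n * cnj (seq y n)))"
    using summable_mult_square_summable[OF summable_seq summable_seq, of x y]
    by (simp add: norm_mult)
qed

lemma inner_eq_Re_cinner: "x \<bullet> y = Re (cinner x y)"
  unfolding cinner_def inner_ell2_def Re_suminf[OF summable_cinner]
  by (simp add: inner_complex_def)


section \<open>Hyponormal operators\<close>

definition bounded_operator :: "(ell2 \<Rightarrow> ell2) \<Rightarrow> bool"
  where "bounded_operator T \<longleftrightarrow> bounded_linear T \<and> (\<forall>k x. T (k *\<^sub>C x) = k *\<^sub>C T x)"

text \<open>The adjoint exists (Riesz) and is unique whenever \<open>T\<close> is a \<open>bounded_operator\<close>;
  for other \<open>T\<close> the value is unspecified.\<close>

definition adjoint_operator :: "(ell2 \<Rightarrow> ell2) \<Rightarrow> ell2 \<Rightarrow> ell2"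
  where "adjoint_operator T = (THE S. \<forall>x y. cinner (T x) y = cinner x (S y))"

definition positive_semidefinite :: "(ell2 \<Rightarrow> ell2) \<Rightarrow> bool"
  where "positive_semidefinite T \<longleftrightarrow> (\<forall>x. cinner (T x) x \<in> \<real>\<^sub>\<ge>\<^sub>0)"

definition hyponormal :: "(ell2 \<Rightarrow> ell2) \<Rightarrow> bool"
  where "hyponormal T \<longleftrightarrow> bounded_operator T \<and>
    positive_semidefinite (\<lambda>x. adjoint_operator T (T x) - T (adjoint_operator T x))"


section \<open>Infinite matrices acting on sequences\<close>

definition matrix_action :: "(nat \<Rightarrow> nat \<Rightarrow> complex) \<Rightarrow> (nat \<Rightarrow> complex) \<Rightarrow> nat \<Rightarrow> complex"
  where "matrix_action A x = (\<lambda>i. \<Sum>j. A i j * x j)"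

text \<open>Meaningful only when \<open>matrix_action A\<close> maps square-summable sequences to
  square-summable sequences, as demanded by \<open>is_bounded_matrix\<close>.\<close>

definition matrix_operator :: "(nat \<Rightarrow> nat \<Rightarrow> complex) \<Rightarrow> ell2 \<Rightarrow> ell2"
  where "matrix_operator A x = Abs_ell2 (matrix_action A (seq x))"

definition is_bounded_matrix :: "(nat \<Rightarrow> nat \<Rightarrow> complex) \<Rightarrow> bool"
  where "is_bounded_matrix A \<longleftrightarrow>
    (\<forall>x i. summable (\<lambda>j. A i j * seq x j)) \<and>
    (\<forall>x. summable (\<lambda>i. (cmod (matrix_action A (seq x) i))\<^sup>2)) \<and>
    bounded_operator (matrix_operator A)"

definition factorable_matrix :: "(nat \<Rightarrow> real) \<Rightarrow> (nat \<Rightarrow> real) \<Rightarrow> nat \<Rightarrow> nat \<Rightarrow> complex"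
  where "factorable_matrix a c i j = (if j \<le> i then complex_of_real (a i * c j) else 0)"

end

theory Submission
  imports Defs
begin

text \<open>
  Write \<open>r\<^sub>k = a\<^sub>k / c\<^sub>k\<close> and, for finitely supported \<open>x\<close>, \<open>s\<^sub>k = \<Sum>j\<le>k. c\<^sub>j x\<^sub>j\<close>, so that
  \<open>(M x)\<^sub>k = a\<^sub>k s\<^sub>k\<close>. Telescoping gives \<open>M x = M\<^sup>* w\<close> for
  \<open>w\<^sub>k = (r\<^sub>k s\<^sub>k - r\<^sub>k\<^sub>+\<^sub>1 s\<^sub>k\<^sub>+\<^sub>1) / a\<^sub>k\<close>, because \<open>r\<^sub>k s\<^sub>k \<longlonglongrightarrow> 0\<close>.
  The two bounds involving \<open>\<delta>\<close> say that \<open>\<delta> (r\<^sub>k - r\<^sub>k\<^sub>+\<^sub>1)\<close> lies between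
  \<open>c\<^sub>k\<^sub>+\<^sub>1\<^sup>2 r\<^sub>k r\<^sub>k\<^sub>+\<^sub>1\<close> and \<open>a\<^sub>k\<^sup>2\<close>, and they yield
  \<open>\<bar>w\<^sub>k\<bar>\<^sup>2 \<le> \<bar>x\<^sub>k\<^sub>+\<^sub>1\<bar>\<^sup>2 + (r\<^sub>k \<bar>s\<^sub>k\<bar>\<^sup>2 - r\<^sub>k\<^sub>+\<^sub>1 \<bar>s\<^sub>k\<^sub>+\<^sub>1\<bar>\<^sup>2) / \<delta>\<close>,
  which telescopes to \<open>\<parallel>w\<parallel> \<le> \<parallel>x\<parallel>\<close>. Hence, with \<open>x\<close> a truncation of \<open>M\<^sup>* y\<close>,
  \<open>\<parallel>x\<parallel>\<^sup>2 = \<langle>y, M x\<rangle> = \<langle>y, M\<^sup>* w\<rangle> = \<langle>M y, w\<rangle> \<le> \<parallel>M y\<parallel> \<parallel>x\<parallel>\<close>, and so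
  \<open>\<parallel>M\<^sup>* y\<parallel> \<le> \<parallel>M y\<parallel>\<close>.
\<close>

section \<open>The inner product and truncations\<close>

lemma cinner_scaleC_left: "cinner (k *\<^sub>C x) y = k * cinner x y"
  unfolding cinner_def
  by (simp add: scaleC_ell2.rep_eq mult.assoc suminf_mult summable_cinner)

lemma cinner_zero_left: "cinner 0 y = 0"
  by (simp add: cinner_def zero_ell2.rep_eq)

lemma cinner_add_left: "cinner (x + y) z = cinner x z + cinner y z"
  unfolding cinner_def
  by (simp add: plus_ell2.rep_eq distrib_right suminf_add[symmetric] summable_cinner)

lemma cinner_diff_left: "cinner (x - y) z = cinner x z - cinner y z"
  unfolding cinner_def
  by (simp add: minus_ell2.rep_eq left_diff_distrib suminf_diff[symmetric] summable_cinner)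

lemma cinner_commute: "cinner y x = cnj (cinner x y)"
proof -
  have "(\<lambda>n. cnj (seq x n * cnj (seq y n))) sums cnj (cinner x y)"
    unfolding cinner_def sums_cnj using summable_cinner by (rule summable_sums)
  then show ?thesis
    unfolding cinner_def by (simp add: mult.commute sums_iff)
qed

lemma cinner_self: "cinner x x = complex_of_real ((norm x)\<^sup>2)"
proof -
  have "(norm x)\<^sup>2 = (\<Sum>n. (cmod (seq x n))\<^sup>2)"
    by (simp add: norm_ell2_def suminf_nonneg summable_seq)
  then show ?thesis
    by (simp only: cinner_def complex_norm_square[symmetric] suminf_of_real[OF summable_seq])
qed

lemma norm_scaleC: "norm (k *\<^sub>C x) = cmod k * norm x"
  by (simp add: norm_ell2_def scaleC_ell2.rep_eq norm_mult power_mult_distrib suminf_mult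
      summable_seq real_sqrt_mult)

text \<open>The real Cauchy-Schwarz inequality only bounds the real part of \<open>cinner\<close>.
  Multiplying \<open>x\<close> by the unimodular \<open>k\<close> rotates \<open>cinner x y\<close>
  onto its modulus without changing the norm of \<open>x\<close>.\<close>

lemma cmod_cinner_le: "cmod (cinner x y) \<le> norm x * norm y"
proof (cases "cinner x y = 0")
  case False
  define k where "k = cnj (sgn (cinner x y))"
  have k: "cmod k = 1"
    using False by (simp add: k_def norm_sgn)
  have "k * cinner x y = cinner x y * cnj (cinner x y) / complex_of_real (cmod (cinner x y))"
    by (simp add: k_def sgn_eq)
  also have "\<dots> = complex_of_real (cmod (cinner x y))"
    unfolding complex_norm_square[symmetric] by (simp add: power2_eq_square)
  finally have "cmod (cinner x y) = (k *\<^sub>C x) \<bullet> y"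
    by (simp add: inner_eq_Re_cinner cinner_scaleC_left)
  also have "\<dots> \<le> norm (k *\<^sub>C x) * norm y"
    by (rule norm_cauchy_schwarz)
  finally show ?thesis
    by (simp add: norm_scaleC k)
qed simp

lemma bounded_linear_cinner_left: "bounded_linear (\<lambda>x. cinner x y)"
proof (rule bounded_linear_intro[where K = "norm y"])
  show "cinner (r *\<^sub>R x) y = r *\<^sub>R cinner x y" for r x
  proof -
    have "r *\<^sub>R x = complex_of_real r *\<^sub>C x"
      by (simp add: seq_inject[symmetric] scaleR_ell2.rep_eq scaleC_ell2.rep_eq fun_eq_iff
          scaleR_conv_of_real)
    then show ?thesis
      by (simp add: cinner_scaleC_left scaleR_conv_of_real)
  qed
qed (simp_all add: cinner_add_left cmod_cinner_le)

section \<open>Unit vectors and finite truncations\<close>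

lift_definition unit_vector :: "nat \<Rightarrow> ell2" is "\<lambda>i n. if n = i then 1 else 0"
  subgoal for i
    by (rule summable_finite[of "{i}"]) auto
  done

lift_definition truncate :: "nat \<Rightarrow> ell2 \<Rightarrow> ell2" is "\<lambda>n x i. if i < n then x i else 0"
  subgoal for n x
    by (rule summable_finite[of "{..<n}"]) auto
  done

lemma cinner_unit_vector_left: "cinner (unit_vector i) y = cnj (seq y i)"
proof -
  have "(\<lambda>n. seq (unit_vector i) n * cnj (seq y n)) = (\<lambda>n. if n = i then cnj (seq y n) else 0)"
    by (auto simp: unit_vector.rep_eq)
  then show ?thesis
    unfolding cinner_def using sums_single[of i "\<lambda>n. cnj (seq y n)"] by (simp add: sums_iff)
qed

lemma norm_truncate: "(norm (truncate n x))\<^sup>2 = (\<Sum>i<n. (cmod (seq x i))\<^sup>2)"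
proof -
  have "(norm (truncate n x))\<^sup>2 = (\<Sum>i. (cmod (seq (truncate n x) i))\<^sup>2)"
    by (simp add: norm_ell2_def suminf_nonneg summable_seq)
  also have "\<dots> = (\<Sum>i<n. (cmod (seq (truncate n x) i))\<^sup>2)"
    by (rule suminf_finite) (auto simp: truncate.rep_eq)
  finally show ?thesis
    by (simp add: truncate.rep_eq)
qed

lemma norm_truncate_tendsto: "(\<lambda>n. (norm (truncate n x))\<^sup>2) \<longlonglongrightarrow> (norm x)\<^sup>2"
  unfolding norm_truncate
  using summable_LIMSEQ[OF summable_seq[of x]]
  by (simp add: norm_ell2_def suminf_nonneg summable_seq)

lemma norm_le_if_truncate_le:
  assumes "\<And>n. norm (truncate n x) \<le> B"
  shows "norm x \<le> B"
proof -
  have "(norm (truncate n x))\<^sup>2 \<le> B\<^sup>2" for n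
    using assms by (intro power_mono) auto
  then have "(norm x)\<^sup>2 \<le> B\<^sup>2"
    using LIMSEQ_le_const2[OF norm_truncate_tendsto] by blast
  moreover have "0 \<le> B"
    using assms[of 0] norm_ge_zero order_trans by blast
  ultimately show ?thesis
    by (rule power2_le_imp_le)
qed

text \<open>Truncation is an orthogonal projection. This yields the convergence of truncations, and
  later turns the norm of a truncated adjoint image into an inner product.\<close>

lemma cinner_truncate_self: "cinner x (truncate n x) = complex_of_real ((norm (truncate n x))\<^sup>2)"
proof -
  have "cinner x (truncate n x) = cinner (truncate n x) (truncate n x)"
    unfolding cinner_def by (rule arg_cong[where f = suminf]) (auto simp: truncate.rep_eq)
  then show ?thesis
    by (simp add: cinner_self)
qed

lemma truncate_tendsto: "(\<lambda>n. truncate n x) \<longlonglongrightarrow> x"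
proof -
  \<comment> \<open>Pythagoras: the tail is orthogonal to the truncation.\<close>
  have "(norm (truncate n x - x))\<^sup>2 = (norm x)\<^sup>2 - (norm (truncate n x))\<^sup>2" for n
    using cinner_truncate_self[of x n]
    by (simp add: power2_norm_eq_inner inner_diff_left inner_diff_right inner_commute
        inner_eq_Re_cinner[of x "truncate n x"])
  then have "(\<lambda>n. (norm (truncate n x - x))\<^sup>2) \<longlonglongrightarrow> 0"
    using tendsto_diff[OF tendsto_const norm_truncate_tendsto, of "(norm x)\<^sup>2" x] by simp
  then have "(\<lambda>n. sqrt ((norm (truncate n x - x))\<^sup>2)) \<longlonglongrightarrow> sqrt 0"
    by (rule tendsto_real_sqrt)
  then have "(\<lambda>n. norm (truncate n x - x)) \<longlonglongrightarrow> 0"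
    by simp
  then show ?thesis
    using LIM_zero_iff tendsto_norm_zero_iff by blast
qed

lemma truncate_0: "truncate 0 x = 0"
  by (simp add: seq_inject[symmetric] truncate.rep_eq zero_ell2.rep_eq)

lemma truncate_Suc: "truncate (Suc n) x = truncate n x + seq x n *\<^sub>C unit_vector n"
  by (auto simp: seq_inject[symmetric] truncate.rep_eq plus_ell2.rep_eq scaleC_ell2.rep_eq
      unit_vector.rep_eq fun_eq_iff less_Suc_eq)

section \<open>Adjoints\<close>

lemma cinner_operator_truncate:
  assumes "bounded_operator T"
  shows "cinner (T (truncate n x)) y = (\<Sum>i<n. seq x i * cinner (T (unit_vector i)) y)"
proof -
  interpret bounded_linear T
    using assms by (simp add: bounded_operator_def)
  have "T (k *\<^sub>C z) = k *\<^sub>C T z" for k z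
    using assms by (simp add: bounded_operator_def)
  then show ?thesis
    by (induction n)
      (simp_all add: truncate_0 zero truncate_Suc add cinner_zero_left cinner_add_left
        cinner_scaleC_left)
qed

text \<open>These are the coordinates that the adjoint must give to the image of \<open>y\<close>.
  If \<open>x\<close> consists of the first \<open>n\<close> of them, then
  \<open>cinner (T x) y\<close> equals \<open>(norm x)\<^sup>2\<close>, so Cauchy-Schwarz and
  boundedness give \<open>norm x \<le> K * norm y\<close>, uniformly in \<open>n\<close>.\<close>

lemma summable_adjoint_coefficients:
  assumes "bounded_operator T"
  shows "summable (\<lambda>i. (cmod (cnj (cinner (T (unit_vector i)) y)))\<^sup>2)"
proof -
  obtain K where K: "\<And>x. norm (T x) \<le> norm x * K" "0 \<le> K"
    using assms bounded_linear.nonneg_bounded unfolding bounded_operator_def by blast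
  define z where "z = (\<lambda>i. cnj (cinner (T (unit_vector i)) y))"
  have "(\<Sum>i<n. (cmod (z i))\<^sup>2) \<le> (K * norm y)\<^sup>2" for n
  proof -
    have sq: "summable (\<lambda>i. (cmod (if i < n then z i else 0))\<^sup>2)"
      by (rule summable_finite[of "{..<n}"]) auto
    define x where "x = Abs_ell2 (\<lambda>i. if i < n then z i else 0)"
    have seq_x: "seq x = (\<lambda>i. if i < n then z i else 0)"
      unfolding x_def using sq by (simp add: Abs_ell2_inverse)
    have tx: "truncate n x = x"
      by (auto simp: seq_inject[symmetric] truncate.rep_eq seq_x)
    have nx: "(norm x)\<^sup>2 = (\<Sum>i<n. (cmod (z i))\<^sup>2)"
      using norm_truncate[of n x] by (simp add: tx seq_x)
    have "cinner (T x) y = complex_of_real ((norm x)\<^sup>2)"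
      using cinner_operator_truncate[OF assms, of n x y]
      by (simp add: tx seq_x nx complex_norm_square[unfolded of_real_power] z_def mult.commute)
    then have "(norm x)\<^sup>2 \<le> norm (T x) * norm y"
      using cmod_cinner_le[of "T x" y] by (metis norm_of_real abs_of_nonneg zero_le_power2)
    also have "\<dots> \<le> norm x * (K * norm y)"
      using mult_right_mono[OF K(1)[of x], of "norm y"] by (simp add: mult.assoc)
    finally have "norm x \<le> K * norm y"
      using K(2) by (cases "norm x = 0") (auto simp: power2_eq_square)
    then show ?thesis
      unfolding nx[symmetric] by (intro power_mono) auto
  qed
  then show ?thesis
    unfolding z_def by (intro summableI_nonneg_bounded) auto
qed

text \<open>The adjoint is built from its coordinates. The identity holds on truncations by
  linearity and passes to the limit by continuity; testing on unit vectors gives the uniqueness that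
  the definite description needs.\<close>

lemma cinner_adjoint:
  assumes "bounded_operator T"
  shows "cinner (T x) y = cinner x (adjoint_operator T y)"
proof -
  define S where "S y = Abs_ell2 (\<lambda>i. cnj (cinner (T (unit_vector i)) y))" for y
  have seq_S: "seq (S y) i = cnj (cinner (T (unit_vector i)) y)" for y i
    unfolding S_def using summable_adjoint_coefficients[OF assms, of y]
    by (simp add: Abs_ell2_inverse)
  have S: "cinner (T x) y = cinner x (S y)" for x y
  proof (rule LIMSEQ_unique)
    show "(\<lambda>n. cinner (T (truncate n x)) y) \<longlonglongrightarrow> cinner (T x) y"
      using assms
      by (intro bounded_linear.tendsto[OF bounded_linear_cinner_left]
          bounded_linear.tendsto[of T] truncate_tendsto) (simp add: bounded_operator_def)
    show "(\<lambda>n. cinner (T (truncate n x)) y) \<longlonglongrightarrow> cinner x (S y)"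
      unfolding cinner_operator_truncate[OF assms]
      using summable_LIMSEQ[OF summable_cinner[of x "S y"]]
      by (simp add: seq_S cinner_def)
  qed
  have "adjoint_operator T = S"
    unfolding adjoint_operator_def
  proof (rule the_equality)
    fix S' assume "\<forall>x y. cinner (T x) y = cinner x (S' y)"
    then have "cinner (unit_vector i) (S' y) = cinner (unit_vector i) (S y)" for i y
      by (simp add: S[symmetric])
    then show "S' = S"
      by (simp add: cinner_unit_vector_left fun_eq_iff seq_inject[symmetric])
  qed (simp add: S)
  with S show ?thesis
    by simp
qed

lemma seq_adjoint:
  assumes "bounded_operator T"
  shows "seq (adjoint_operator T y) i = cnj (cinner (T (unit_vector i)) y)"
  by (simp add: cinner_adjoint[OF assms] cinner_unit_vector_left)

section \<open>Criteria for hyponormality\<close>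

text \<open>The quadratic form of the self-commutator at \<open>x\<close> is the difference of the
  squared norms of \<open>T x\<close> and \<open>adjoint_operator T x\<close>.\<close>

lemma hyponormal_if_norm_adjoint_le:
  assumes T: "bounded_operator T"
    and le: "\<And>x. norm (adjoint_operator T x) \<le> norm (T x)"
  shows "hyponormal T"
proof -
  have "cinner (adjoint_operator T (T x) - T (adjoint_operator T x)) x
      = complex_of_real ((norm (T x))\<^sup>2 - (norm (adjoint_operator T x))\<^sup>2)" for x
    using cinner_commute[of "adjoint_operator T (T x)" x]
    by (simp add: cinner_diff_left cinner_adjoint[OF T] cinner_self
        cinner_adjoint[OF T, of x "T x", symmetric])
  moreover have "0 \<le> (norm (T x))\<^sup>2 - (norm (adjoint_operator T x))\<^sup>2" for x
    using power_mono[OF le, of x 2] by simp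
  ultimately have "cinner (adjoint_operator T (T x) - T (adjoint_operator T x)) x \<in> \<real>\<^sub>\<ge>\<^sub>0" for x
    by (simp only: nonneg_Reals_of_real_iff)
  with T show ?thesis
    by (simp add: hyponormal_def positive_semidefinite_def)
qed

text \<open>A form of Douglas' factorization \<open>T = T\<^sup>* B\<close> with a contraction \<open>B\<close>, needed only on
  finitely supported vectors.\<close>

lemma hyponormal_if_factors_through_adjoint:
  assumes T: "bounded_operator T"
    and factor: "\<And>n y. \<exists>w. norm w \<le> norm (truncate n y) \<and>
      adjoint_operator T w = T (truncate n y)"
  shows "hyponormal T"
proof (rule hyponormal_if_norm_adjoint_le[OF T], rule norm_le_if_truncate_le)
  fix x n
  let ?z = "adjoint_operator T x"
  let ?y = "truncate n ?z"
  obtain w where w: "norm w \<le> norm ?y" "adjoint_operator T w = T ?y"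
    using factor by blast
  have "complex_of_real ((norm ?y)\<^sup>2) = cnj (cinner ?y ?z)"
    unfolding cinner_truncate_self[symmetric] by (rule cinner_commute)
  also have "\<dots> = cinner x (T ?y)"
    unfolding cinner_adjoint[OF T, symmetric] by (rule cinner_commute[symmetric])
  also have "\<dots> = cinner (T x) w"
    by (simp add: cinner_adjoint[OF T] w(2))
  finally have "(norm ?y)\<^sup>2 \<le> norm (T x) * norm w"
    using cmod_cinner_le[of "T x" w] by (metis norm_of_real abs_of_nonneg zero_le_power2)
  also have "\<dots> \<le> norm (T x) * norm ?y"
    by (intro mult_left_mono w) simp
  finally show "norm ?y \<le> norm (T x)"
    by (cases "norm ?y = 0") (auto simp: power2_eq_square)
qed

section \<open>Factorable matrices\<close>

lemma seq_matrix_operator: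
  assumes "is_bounded_matrix A"
  shows "seq (matrix_operator A x) = matrix_action A (seq x)"
  unfolding matrix_operator_def
  using assms by (simp add: is_bounded_matrix_def Abs_ell2_inverse)

lemma matrix_action_factorable:
  "matrix_action (factorable_matrix a c) x i
    = complex_of_real (a i) * (\<Sum>j\<le>i. complex_of_real (c j) * x j)"
proof -
  have "matrix_action (factorable_matrix a c) x i = (\<Sum>j\<le>i. factorable_matrix a c i j * x j)"
    unfolding matrix_action_def by (rule suminf_finite) (auto simp: factorable_matrix_def)
  then show ?thesis
    by (simp add: factorable_matrix_def sum_distrib_left mult.assoc)
qed

section \<open>The contraction estimate\<close>

text \<open>Both sides have the same cross term in \<open>s\<close> and \<open>t\<close>. The form
  is chosen so that the last factor telescopes along a sequence.\<close>

lemma cmod_weighted_diff: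
  fixes s t :: complex and r r' :: real
  shows "(cmod (complex_of_real r * s - complex_of_real r' * t))\<^sup>2
    = r * r' * (cmod (t - s))\<^sup>2 + (r - r') * (r * (cmod s)\<^sup>2 - r' * (cmod t)\<^sup>2)"
  unfolding cmod_power2 by (simp add: power2_eq_square algebra_simps)

text \<open>For consecutive weighted sums \<open>s\<close> and \<open>t\<close>, the quotient
  \<open>(t - s) / c\<close> is the next entry of \<open>x\<close>. Replacing the denominator
  \<open>a\<^sup>2\<close> by the smaller \<open>\<delta> * (r - r')\<close> cancels the factor
  \<open>r - r'\<close> in the telescoping term of \<open>cmod_weighted_diff\<close>;
  \<open>lower\<close> then bounds the other coefficient by \<open>1 / c\<^sup>2\<close>.\<close>

lemma contraction_step:
  fixes s t :: complex and r r' a c \<delta> :: real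
  assumes "a > 0" "c > 0" "\<delta> > 0" "r' < r"
    and lower: "c\<^sup>2 * (r * r') \<le> \<delta> * (r - r')"
    and upper: "\<delta> * (r - r') \<le> a\<^sup>2"
  shows "(cmod ((complex_of_real r * s - complex_of_real r' * t) / complex_of_real a))\<^sup>2
    \<le> (cmod ((t - s) / complex_of_real c))\<^sup>2 + (r * (cmod s)\<^sup>2 - r' * (cmod t)\<^sup>2) / \<delta>"
proof -
  define N where "N = (cmod (complex_of_real r * s - complex_of_real r' * t))\<^sup>2"
  define D where "D = (cmod (t - s))\<^sup>2"
  define E where "E = r * (cmod s)\<^sup>2 - r' * (cmod t)\<^sup>2"
  have pos: "0 < \<delta> * (r - r')"
    using assms by simp
  have "(cmod ((complex_of_real r * s - complex_of_real r' * t) / complex_of_real a))\<^sup>2 = N / a\<^sup>2"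
    by (simp add: N_def norm_divide power_divide)
  also have "\<dots> \<le> N / (\<delta> * (r - r'))"
    using upper assms by (intro divide_left_mono mult_pos_pos) (auto simp: N_def)
  also have "\<dots> = (r * r' / (\<delta> * (r - r'))) * D + E / \<delta>"
    using assms cmod_weighted_diff[of r s r' t] by (simp add: N_def D_def E_def add_divide_distrib)
  also have "r * r' / (\<delta> * (r - r')) \<le> 1 / c\<^sup>2"
    using lower pos assms by (simp add: field_simps)
  then have "(r * r' / (\<delta> * (r - r'))) * D + E / \<delta> \<le> 1 / c\<^sup>2 * D + E / \<delta>"
    by (intro add_mono mult_right_mono) (auto simp: D_def)
  also have "1 / c\<^sup>2 * D = (cmod ((t - s) / complex_of_real c))\<^sup>2"
    by (simp add: D_def norm_divide power_divide)
  finally show ?thesis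
    by (simp add: E_def)
qed

lemma contraction_partial_sums:
  fixes a c r :: "nat \<Rightarrow> real" and x :: "nat \<Rightarrow> complex" and \<delta> :: real
  defines "s \<equiv> \<lambda>k. \<Sum>j\<le>k. complex_of_real (c j) * x j"
  assumes "\<And>k. a k > 0" "\<And>k. c k > 0" "\<delta> > 0" "\<And>k. r k > 0" "\<And>k. r (Suc k) < r k"
    and zero: "(c 0)\<^sup>2 * r 0 \<le> \<delta>"
    and lower: "\<And>k. (c (Suc k))\<^sup>2 * (r k * r (Suc k)) \<le> \<delta> * (r k - r (Suc k))"
    and upper: "\<And>k. \<delta> * (r k - r (Suc k)) \<le> (a k)\<^sup>2"
  shows "(\<Sum>k<n. (cmod ((complex_of_real (r k) * s k - complex_of_real (r (Suc k)) * s (Suc k))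
      / complex_of_real (a k)))\<^sup>2) \<le> (\<Sum>k\<le>n. (cmod (x k))\<^sup>2)"
    (is "(\<Sum>k<n. ?w k) \<le> _")
proof -
  let ?e = "\<lambda>k. r k * (cmod (s k))\<^sup>2 / \<delta>"
  have "?w k \<le> (cmod (x (Suc k)))\<^sup>2 + (?e k - ?e (Suc k))" for k
    using contraction_step[of "a k" "c (Suc k)" \<delta> "r (Suc k)" "r k" "s k" "s (Suc k)"] assms(2-)
    by (simp add: s_def diff_divide_distrib less_imp_neq[symmetric])
  then have "(\<Sum>k<n. ?w k) \<le> (\<Sum>k<n. (cmod (x (Suc k)))\<^sup>2 + (?e k - ?e (Suc k)))"
    by (rule sum_mono)
  also have "\<dots> = (\<Sum>k<n. (cmod (x (Suc k)))\<^sup>2) + (?e 0 - ?e n)"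
    unfolding sum.distrib by (subst sum_lessThan_telescope') rule
  also have "?e 0 - ?e n \<le> ?e 0"
    using assms(4,5) by (simp add: less_imp_le)
  \<comment> \<open>The steps only supply the squares of \<open>x 1\<close> up to
    \<open>x n\<close>. By \<open>zero\<close>, the initial value left over from telescoping is at
    most the missing square of \<open>x 0\<close>.\<close>
  also have "?e 0 = ((c 0)\<^sup>2 * r 0 / \<delta>) * (cmod (x 0))\<^sup>2"
    by (simp add: s_def norm_mult power_mult_distrib)
  also have "\<dots> \<le> 1 * (cmod (x 0))\<^sup>2"
    using zero assms(4) by (intro mult_right_mono) auto
  also have "(\<Sum>k<n. (cmod (x (Suc k)))\<^sup>2) + 1 * (cmod (x 0))\<^sup>2 = (\<Sum>k\<le>n. (cmod (x k))\<^sup>2)"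
    by (simp add: sum.atMost_shift)
  finally show ?thesis
    by simp
qed

section \<open>Factorization through the adjoint\<close>

text \<open>Column \<open>i\<close> of the matrix has entries \<open>a k * c i\<close> from row
  \<open>i\<close> on. The factor \<open>a k\<close> cancels the denominator in \<open>w\<close>,
  which leaves a telescoping series starting at \<open>i\<close>.\<close>

lemma cinner_factorable_unit_vector:
  fixes t :: "nat \<Rightarrow> complex"
  assumes M: "is_bounded_matrix (factorable_matrix a c)" and "\<And>k. a k > 0" "t \<longlonglongrightarrow> 0"
    and w: "\<And>k. seq w k = (t k - t (Suc k)) / complex_of_real (a k)"
  shows "cinner (matrix_operator (factorable_matrix a c) (unit_vector i)) w
    = complex_of_real (c i) * cnj (t i)"
proof -
  let ?u = "matrix_operator (factorable_matrix a c) (unit_vector i)"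
  have u: "seq ?u k = (if i \<le> k then complex_of_real (a k * c i) else 0)" for k
  proof -
    have "(\<Sum>j\<le>k. complex_of_real (c j) * seq (unit_vector i) j)
        = (\<Sum>j\<le>k. if j = i then complex_of_real (c j) else 0)"
      by (intro sum.cong) (auto simp: unit_vector.rep_eq)
    then show ?thesis
      by (simp add: seq_matrix_operator[OF M] matrix_action_factorable)
  qed
  \<comment> \<open>Differences of \<open>t (max i k)\<close> vanish for \<open>k < i\<close>, so
    the sum from \<open>i\<close> on becomes a telescoping series over all \<open>k\<close>.\<close>
  have "(\<lambda>k. t (max i k)) \<longlonglongrightarrow> 0"
    by (rule Lim_transform_eventually[OF \<open>t \<longlonglongrightarrow> 0\<close>])
      (auto intro!: eventually_sequentiallyI[of i] simp: max_def)
  then have "(\<lambda>k. cnj (t (max i k))) \<longlonglongrightarrow> cnj 0"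
    by (rule tendsto_cnj)
  from sums_mult[OF telescope_sums'[OF this], of "complex_of_real (c i)"]
  have "(\<lambda>k. complex_of_real (c i) * (cnj (t (max i k)) - cnj (t (max i (Suc k)))))
      sums (complex_of_real (c i) * cnj (t i))"
    by simp
  moreover have "seq ?u k * cnj (seq w k)
      = complex_of_real (c i) * (cnj (t (max i k)) - cnj (t (max i (Suc k))))" for k
    using assms(2)[of k] by (auto simp: u w max_def not_less_eq_eq le_Suc_eq)
  ultimately show ?thesis
    unfolding cinner_def by (simp add: sums_iff)
qed

lemma factorable_factors_through_adjoint:
  fixes a c :: "nat \<Rightarrow> real" and \<delta> :: real
  defines "r \<equiv> \<lambda>k. a k / c k" and "T \<equiv> matrix_operator (factorable_matrix a c)"
  assumes a: "\<And>k. a k > 0" and c: "\<And>k. c k > 0"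
    and M: "is_bounded_matrix (factorable_matrix a c)"
    and "\<delta> > 0" and decr: "\<And>k. r (Suc k) < r k" and lim: "r \<longlonglongrightarrow> 0"
    and zero: "(c 0)\<^sup>2 * r 0 \<le> \<delta>"
    and lower: "\<And>k. (c (Suc k))\<^sup>2 * (r k * r (Suc k)) \<le> \<delta> * (r k - r (Suc k))"
    and upper: "\<And>k. \<delta> * (r k - r (Suc k)) \<le> (a k)\<^sup>2"
  shows "\<exists>w. norm w \<le> norm (truncate m y) \<and> adjoint_operator T w = T (truncate m y)"
proof -
  have T: "bounded_operator T"
    using M by (simp add: T_def is_bounded_matrix_def)
  define x where "x = truncate m y"
  define s where "s = (\<lambda>k. \<Sum>j\<le>k. complex_of_real (c j) * seq x j)"
  define t where "t = (\<lambda>k. complex_of_real (r k) * s k)"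
  define f where "f = (\<lambda>k. (t k - t (Suc k)) / complex_of_real (a k))"
  \<comment> \<open>Here the finite support of \<open>x\<close> enters: \<open>s\<close> is constant
    from \<open>m\<close> on, so \<open>t\<close> inherits the limit 0 from
    \<open>r\<close>.\<close>
  have "complex_of_real (r k) * s m = t k" if "m \<le> k" for k
  proof -
    have "s k = s m"
      unfolding s_def using that
      by (intro sum.mono_neutral_right) (auto simp: x_def truncate.rep_eq)
    then show ?thesis
      by (simp add: t_def)
  qed
  then have "\<forall>\<^sub>F k in sequentially. complex_of_real (r k) * s m = t k"
    by (rule eventually_sequentiallyI)
  moreover have "(\<lambda>k. complex_of_real (r k) * s m) \<longlonglongrightarrow> 0"
    using tendsto_mult_right[OF tendsto_of_real[OF lim], of "s m"] by simp
  ultimately have t: "t \<longlonglongrightarrow> 0"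
    using Lim_transform_eventually by blast
  have x_le: "(\<Sum>k<n. (cmod (seq x k))\<^sup>2) \<le> (norm x)\<^sup>2" for n
    using sum_le_suminf[OF summable_seq[of x], of "{..<n}"]
    by (simp add: norm_ell2_def suminf_nonneg summable_seq)
  have f_le: "(\<Sum>k<n. (cmod (f k))\<^sup>2) \<le> (norm x)\<^sup>2" for n
  proof -
    have "r k > 0" for k
      using a c by (simp add: r_def)
    from contraction_partial_sums[where n = n and x = "seq x",
        OF a c \<open>\<delta> > 0\<close> this decr zero lower upper]
    \<comment> \<open>The entry \<open>f k\<close> involves \<open>s (Suc k)\<close>, so
      \<open>n\<close> terms of \<open>f\<close> need \<open>n + 1\<close> terms of
      \<open>x\<close>.\<close>
    have "(\<Sum>k<n. (cmod (f k))\<^sup>2) \<le> (\<Sum>k<Suc n. (cmod (seq x k))\<^sup>2)"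
      unfolding f_def t_def s_def lessThan_Suc_atMost .
    also have "\<dots> \<le> (norm x)\<^sup>2"
      by (rule x_le)
    finally show ?thesis .
  qed
  then have f_sq: "summable (\<lambda>k. (cmod (f k))\<^sup>2)"
    by (intro summableI_nonneg_bounded) auto
  define w where "w = Abs_ell2 f"
  have w: "seq w = f"
    unfolding w_def using f_sq by (simp add: Abs_ell2_inverse)
  have "norm w \<le> norm x"
  proof (rule norm_le_if_truncate_le, rule power2_le_imp_le)
    show "(norm (truncate n w))\<^sup>2 \<le> (norm x)\<^sup>2" for n
      by (simp add: norm_truncate w f_le)
  qed simp
  moreover have "adjoint_operator T w = T x"
  proof -
    have "seq (adjoint_operator T w) i = seq (T x) i" for i
    proof -
      have "cinner (T (unit_vector i)) w = complex_of_real (c i) * cnj (t i)"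
        unfolding T_def by (rule cinner_factorable_unit_vector[OF M a t]) (simp add: w f_def)
      then have "seq (adjoint_operator T w) i = complex_of_real (c i) * t i"
        by (simp add: seq_adjoint[OF T])
      \<comment> \<open>This is where the weight \<open>r i = a i / c i\<close> is needed: it trades
        the column factor \<open>c i\<close> for the row factor \<open>a i\<close>.\<close>
      also have "\<dots> = complex_of_real (a i) * s i"
        using c[of i] by (simp add: t_def r_def)
      also have "\<dots> = seq (T x) i"
        by (simp add: T_def seq_matrix_operator[OF M] matrix_action_factorable s_def)
      finally show ?thesis .
    qed
    then show ?thesis
      by (simp add: seq_inject[symmetric] fun_eq_iff)
  qed
  ultimately show ?thesis
    unfolding x_def by blast
qed

theorem theorem6:
  fixes a c :: "nat \<Rightarrow> real"
  assumes "\<And>i. a i > 0" and "\<And>j. c j > 0"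
    and "is_bounded_matrix (factorable_matrix a c)"
    and "\<And>k. a (Suc k) / c (Suc k) < a k / c k"
    and "(\<lambda>k. a k / c k) \<longlonglongrightarrow> 0"
    and "bounded (range (\<lambda>k. (a k * c k) / (a (Suc k) * c (Suc k))))"
    and "\<exists>\<delta>>0. 0 < c 0 * a 0 \<and> c 0 * a 0 \<le> \<delta> \<and>
      (\<forall>k. (1 / \<delta>) * (a k / c k) * (\<delta> - c k * a k) \<le> a (Suc k) / c (Suc k) \<and>
           a (Suc k) / c (Suc k) \<le> (\<delta> * (a k / c k)) / (\<delta> + (c (Suc k))\<^sup>2 * (a k / c k)))"
  shows "hyponormal (matrix_operator (factorable_matrix a c))"
proof -
  obtain \<delta> where \<delta>: "\<delta> > 0" "c 0 * a 0 \<le> \<delta>"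
    and lo: "\<And>k. (1 / \<delta>) * (a k / c k) * (\<delta> - c k * a k) \<le> a (Suc k) / c (Suc k)"
    and up: "\<And>k. a (Suc k) / c (Suc k) \<le> (\<delta> * (a k / c k)) / (\<delta> + (c (Suc k))\<^sup>2 * (a k / c k))"
    using assms(7) by blast
  have zero: "(c 0)\<^sup>2 * (a 0 / c 0) \<le> \<delta>"
    using \<delta> assms(2)[of 0] by (simp add: power2_eq_square)
  \<comment> \<open>Clearing the positive denominator turns the upper bound on the next ratio into a
    lower bound on the drop between consecutive ratios.\<close>
  have lower: "(c (Suc k))\<^sup>2 * (a k / c k * (a (Suc k) / c (Suc k)))
      \<le> \<delta> * (a k / c k - a (Suc k) / c (Suc k))" for k
  proof -
    have "0 < \<delta> + (c (Suc k))\<^sup>2 * (a k / c k)"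
      using \<delta>(1) assms(1,2) by (simp add: add_pos_nonneg less_imp_le)
    with up[of k] have "a (Suc k) / c (Suc k) * (\<delta> + (c (Suc k))\<^sup>2 * (a k / c k)) \<le> \<delta> * (a k / c k)"
      by (simp only: pos_le_divide_eq)
    then show ?thesis
      by (simp only: distrib_left right_diff_distrib mult_ac)
  qed
  \<comment> \<open>Conversely, the lower bound on the next ratio, multiplied by
    \<open>\<delta>\<close>, bounds the drop from above, since
    \<open>(a k / c k) * (c k * a k)\<close> is \<open>(a k)\<^sup>2\<close>.\<close>
  have upper: "\<delta> * (a k / c k - a (Suc k) / c (Suc k)) \<le> (a k)\<^sup>2" for k
  proof -
    have "\<delta> * ((1 / \<delta>) * (a k / c k) * (\<delta> - c k * a k)) \<le> \<delta> * (a (Suc k) / c (Suc k))"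
      using lo \<delta>(1) by (intro mult_left_mono) auto
    moreover have "\<delta> * ((1 / \<delta>) * (a k / c k) * (\<delta> - c k * a k)) = \<delta> * (a k / c k) - (a k)\<^sup>2"
      using \<delta>(1) assms(2)[of k] by (simp add: field_simps power2_eq_square)
    ultimately show ?thesis
      by (simp add: right_diff_distrib)
  qed
  show ?thesis
  proof (rule hyponormal_if_factors_through_adjoint)
    show "bounded_operator (matrix_operator (factorable_matrix a c))"
      using assms(3) by (simp add: is_bounded_matrix_def)
    show "\<exists>w. norm w \<le> norm (truncate n y) \<and>
        adjoint_operator (matrix_operator (factorable_matrix a c)) w
          = matrix_operator (factorable_matrix a c) (truncate n y)" for n y
      by (rule factorable_factors_through_adjoint[OF assms(1-3) \<delta>(1) assms(4,5) zero lower upper])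
  qed
qed

end
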